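(* For each $n\ge1$, let $\lambda>16$ (possibly depending on $n$), let $z\in\{\pm1\}^n$ be a fixed vector, let $\sigma=\sqrt n/\lambda$ (so that $\lambda>16$ is equivalent to $\sigma<\frac1{16}\sqrt n$), and let $Y=zz^T+\sigma W$, where $W\in\mathbb{R}^{n\times n}$ is a random symmetric matrix with $W_{ii}=0$ for all $i$ and with entries $W_{ij}$, $i>j$, i.i.d. $\mathcal{N}(0,1)$. Then for any $\varepsilon>0$, with high probability, every second-order critical point $Q\in\mathbb{R}^{n\times2}$ of the problem $$\max_{Q\in\mathbb{R}^{n\times 2}} \operatorname{Tr}(Q^TYQ)\quad\text{s.t. } \|Q_{i:}\|_2^2=1,\ 1\le i\le n,$$ satisfies $$\frac1n\|Q^Tz\|_2\ \ge\ 1-(1+\varepsilon)\frac{16}{\lambda}\ =\ 1-(1+\varepsilon)\frac{16\sigma}{\sqrt n}.$$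
   Context: $Q_{i:}$ denotes the $i$th row of $Q$. "With high probability" means with probability tending to $1$ as $n\to\infty$. The operator $\mathrm{ddiag}$ maps a square matrix to the diagonal matrix obtained by setting all off-diagonal entries to zero; $\circ$ is the entrywise (Hadamard) product. For a symmetric cost matrix $A\in\mathbb{R}^{n\times n}$, a second-order critical point of $\max\{\operatorname{Tr}(Q^TAQ): Q\in\mathbb{R}^{n\times 2},\ \|Q_{i:}\|_2=1\ \forall i\}$ is a feasible $Q$ satisfying the first-order condition $(\mathrm{ddiag}(AQQ^T)-A)Q=0$ and the second-order condition $\mathrm{ddiag}(AQQ^T)-A\circ(QQ^T)\succeq 0$. *)

theory Defs
  imports "HOL-Probability.Probability" "Jordan_Normal_Form.Matrix"
begin

hide_const (open) Finite_Cartesian_Product.vec Finite_Cartesian_Product.row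
hide_type (open) Finite_Cartesian_Product.vec
unbundle no vec_syntax and no inner_syntax

definition ddiag :: "'a::zero mat \<Rightarrow> 'a mat" where
  "ddiag A = mat_diag (dim_row A) (\<lambda>i. A $$ (i, i))"

definition hadamard :: "'a::times mat \<Rightarrow> 'a mat \<Rightarrow> 'a mat" (infixl \<open>\<circ>\<^sub>m\<close> 70) where
  "A \<circ>\<^sub>m B = mat (dim_row A) (dim_col A) (\<lambda>ij. A $$ ij * B $$ ij)"

definition outer_prod :: "'a::times vec \<Rightarrow> 'a vec \<Rightarrow> 'a mat" where
  "outer_prod u v = mat (dim_vec u) (dim_vec v) (\<lambda>(i, j). u $ i * v $ j)"

definition l2_norm_vec :: "real vec \<Rightarrow> real" where
  "l2_norm_vec v = L2_set (\<lambda>i. v $ i) {..<dim_vec v}"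

definition psd_mat :: "nat \<Rightarrow> real mat \<Rightarrow> bool" where
  "psd_mat n S \<longleftrightarrow> S \<in> carrier_mat n n \<and> S\<^sup>T = S \<and>
     (\<forall>x \<in> carrier_vec n. 0 \<le> x \<bullet> (S *\<^sub>v x))"

definition feasible :: "nat \<Rightarrow> real mat \<Rightarrow> bool" where
  "feasible n Q \<longleftrightarrow> Q \<in> carrier_mat n 2 \<and> (\<forall>i<n. (l2_norm_vec (row Q i))\<^sup>2 = 1)"

(* Critical points of the maximization of Tr (Q\<^sup>T A Q) over all feasible Q:
   (ddiag (A Q Q\<^sup>T) - A) Q is, up to a factor -2, the Riemannian gradient, and the
   matrix in the last conjunct is minus the Hessian, up to a positive factor, when the
   tangent space is identified with n-vectors by rotating each row of Q by a right angle
   (for unit rows this needs exactly two columns).  A is meant to be symmetric. *)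
definition second_order_critical_point :: "nat \<Rightarrow> real mat \<Rightarrow> real mat \<Rightarrow> bool" where
  "second_order_critical_point n A Q \<longleftrightarrow>
     feasible n Q \<and>
     (ddiag (A * Q * Q\<^sup>T) - A) * Q = 0\<^sub>m n 2 \<and>
     psd_mat n (ddiag (A * Q * Q\<^sup>T) - A \<circ>\<^sub>m (Q * Q\<^sup>T))"

(* The entries above the diagonal are determined by symmetry, which is required pointwise. *)
definition gaussian_wigner :: "'w measure \<Rightarrow> nat \<Rightarrow> ('w \<Rightarrow> real mat) \<Rightarrow> bool" where
  "gaussian_wigner M n W \<longleftrightarrow>
     (\<forall>\<omega>\<in>space M. W \<omega> \<in> carrier_mat n n \<and> (W \<omega>)\<^sup>T = W \<omega> \<and> (\<forall>i<n. W \<omega> $$ (i, i) = 0)) \<and>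
     prob_space.indep_vars M (\<lambda>_. borel) (\<lambda>ij \<omega>. W \<omega> $$ ij) {(i, j). j < i \<and> i < n} \<and>
     (\<forall>i<n. \<forall>j<i. distributed M lborel (\<lambda>\<omega>. W \<omega> $$ (i, j)) std_normal_density)"

end

theory Submission
  imports Defs
begin

text \<open>
  Regard the rows of \<open>Q\<close> as unit complex numbers \<open>q\<^sub>i\<close>, and replace \<open>q\<^sub>i\<close> by \<open>z\<^sub>i q\<^sub>i\<close> so that
  \<open>z = 1\<close> and \<open>Y = 1 1\<^sup>T + E\<close>. No operator norm of \<open>W\<close> is needed: a union bound over sign
  vectors shows that \<open>\<bar>x\<^sup>T W x\<bar>\<close> and \<open>\<bar>z\<^sup>T W x\<bar>\<close> are below \<open>1.7 n\<^bsup>3/2\<^esup>\<close> for all sign vectors \<open>x\<close> with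
  high probability (as \<open>1.7\<^sup>2 / 4 > ln 2\<close>). Since \<open>W\<close> has zero diagonal, these forms are
  multi-affine, so the bounds extend to the whole cube \<open>[-1, 1]\<^sup>n\<close>.

  With \<open>X\<^sub>i\<^sub>j = \<langle>q\<^sub>i, q\<^sub>j\<rangle>\<close>, \<open>\<rho> = \<bar>\<Sum>q\<^sub>i\<bar> / n\<close> and \<open>\<beta> = 1.7 / \<lambda>\<close>, testing the second-order condition on
  the real and imaginary parts of \<open>q\<close> gives \<open>\<rho>\<^sup>2 \<ge> 1/2 - 7\<beta>/2\<close>; testing it on unit vectors gives
  nonnegative multipliers \<open>D\<^sub>i\<close>. The first-order condition reads \<open>D\<^sub>i q\<^sub>i = \<rho> n e + g\<^sub>i\<close> with
  \<open>\<bar>e\<bar> = 1\<close> and \<open>g = E q\<close>, whence \<open>\<rho> n (1 - \<langle>q\<^sub>i, e\<rangle>) \<le> \<langle>g\<^sub>i, q\<^sub>i - e\<rangle>\<close>; summing over \<open>i\<close> yields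
  \<open>\<rho> (1 - \<rho>) \<le> 3\<beta>\<close>, and the lower bound on \<open>\<rho>\<close> selects the root near \<open>1\<close>.

  The event is measurable because the critical points range over a compact set on which the
  criticality conditions are closed, so the exceptional set of matrices is an \<open>F\<^sub>\<sigma>\<close>.
\<close>

section \<open>Forms on the cube\<close>

text \<open>By \<open>affine\<close>, the value at a coordinate in [-1, 1] is a convex combination
  of the values at its endpoints. \<open>S\<close> holds the coordinates that may still be interior;
  the induction moves them to endpoints one at a time.\<close>

lemma multiaffine_le_on_cube:
  fixes f :: "('i \<Rightarrow> real) \<Rightarrow> real"
  assumes affine: "\<And>x k t. f (x(k := t)) = (1 - t) / 2 * f (x(k := -1)) + (1 + t) / 2 * f (x(k := 1))"
    and vertex: "\<And>x. (\<And>i. \<bar>x i\<bar> = 1) \<Longrightarrow> f x \<le> B"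
    and "finite S" "\<And>i. \<bar>x i\<bar> \<le> 1" "\<And>i. i \<notin> S \<Longrightarrow> \<bar>x i\<bar> = 1"
  shows "f x \<le> B"
  using assms(3-)
proof (induction S arbitrary: x rule: finite_induct)
  case empty
  then show ?case using vertex by auto
next
  case (insert k S)
  have "f (x(k := -1)) \<le> B" "f (x(k := 1)) \<le> B"
    using insert.prems by (auto intro!: insert.IH)
  moreover have "0 \<le> (1 - x k) / 2" "0 \<le> (1 + x k) / 2"
    using insert.prems(1)[of k] by auto
  ultimately have "(1 - x k) / 2 * f (x(k := -1)) + (1 + x k) / 2 * f (x(k := 1))
      \<le> (1 - x k) / 2 * B + (1 + x k) / 2 * B"
    by (intro add_mono mult_left_mono)
  also have "\<dots> = B" by (simp add: field_simps)
  finally show ?case using affine[of x k "x k"] by simp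
qed

text \<open>A zero diagonal rules out squares of coordinates, so the form is affine in each
  coordinate separately.\<close>

lemma quadratic_form_le_on_cube:
  fixes E :: "nat \<Rightarrow> nat \<Rightarrow> real"
  assumes diag: "\<And>i. i < n \<Longrightarrow> E i i = 0"
    and vertex: "\<And>x. (\<And>i. \<bar>x i\<bar> = 1) \<Longrightarrow> (\<Sum>i<n. \<Sum>j<n. E i j * x i * x j) \<le> B"
    and x: "\<And>i. i < n \<Longrightarrow> \<bar>x i\<bar> \<le> 1"
  shows "(\<Sum>i<n. \<Sum>j<n. E i j * x i * x j) \<le> B"
proof -
  let ?f = "\<lambda>x. \<Sum>i<n. \<Sum>j<n. E i j * x i * x j"
  \<comment> \<open>The default 1 makes every coordinate from \<open>n\<close> on a vertex
    coordinate, as the cube lemma demands, and leaves the sum unchanged.\<close>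
  have "?f (\<lambda>i. if i < n then x i else 1) \<le> B"
  proof (rule multiaffine_le_on_cube[where f = ?f and S = "{..<n}"])
    fix y :: "nat \<Rightarrow> real" and k t
    have "E i j * (y(k := t)) i * (y(k := t)) j
        = (1 - t) / 2 * (E i j * (y(k := -1)) i * (y(k := -1)) j)
          + (1 + t) / 2 * (E i j * (y(k := 1)) i * (y(k := 1)) j)" if "i < n" "j < n" for i j
      using diag[OF that(1)] by (auto simp: field_simps)
    then have "?f (y(k := t)) = (\<Sum>i<n. \<Sum>j<n. (1 - t) / 2 * (E i j * (y(k := -1)) i * (y(k := -1)) j)
          + (1 + t) / 2 * (E i j * (y(k := 1)) i * (y(k := 1)) j))"
      by (intro sum.cong refl) auto
    then show "?f (y(k := t)) = (1 - t) / 2 * ?f (y(k := -1)) + (1 + t) / 2 * ?f (y(k := 1))"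
      by (simp only: sum.distrib sum_distrib_left)
  qed (use vertex x in auto)
  then show ?thesis by simp
qed

lemma linear_form_le_on_cube:
  fixes E :: "nat \<Rightarrow> nat \<Rightarrow> real"
  assumes vertex: "\<And>x. (\<And>i. \<bar>x i\<bar> = 1) \<Longrightarrow> (\<Sum>i<n. \<Sum>j<n. E i j * x j) \<le> B"
    and x: "\<And>i. i < n \<Longrightarrow> \<bar>x i\<bar> \<le> 1"
  shows "(\<Sum>i<n. \<Sum>j<n. E i j * x j) \<le> B"
proof -
  let ?f = "\<lambda>x. \<Sum>i<n. \<Sum>j<n. E i j * x j"
  have "?f (\<lambda>i. if i < n then x i else 1) \<le> B"
  proof (rule multiaffine_le_on_cube[where f = ?f and S = "{..<n}"])
    fix y :: "nat \<Rightarrow> real" and k t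
    have "E i j * (y(k := t)) j
        = (1 - t) / 2 * (E i j * (y(k := -1)) j) + (1 + t) / 2 * (E i j * (y(k := 1)) j)" for i j
      by (auto simp: field_simps)
    then have "?f (y(k := t)) = (\<Sum>i<n. \<Sum>j<n. (1 - t) / 2 * (E i j * (y(k := -1)) j)
          + (1 + t) / 2 * (E i j * (y(k := 1)) j))"
      by (intro sum.cong refl) auto
    then show "?f (y(k := t)) = (1 - t) / 2 * ?f (y(k := -1)) + (1 + t) / 2 * ?f (y(k := 1))"
      by (simp only: sum.distrib sum_distrib_left)
  qed (use vertex x in auto)
  then show ?thesis by simp
qed

section \<open>Critical points on products of circles\<close>

text \<open>The Lagrange multiplier of the constraint \<open>norm (q i) = 1\<close>, that is, the
  i-th diagonal entry of A Q Q^T.\<close>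

definition circle_multiplier :: "nat \<Rightarrow> (nat \<Rightarrow> nat \<Rightarrow> real) \<Rightarrow> (nat \<Rightarrow> complex) \<Rightarrow> nat \<Rightarrow> real" where
  "circle_multiplier n A q i = (\<Sum>j<n. A i j * inner (q i) (q j))"

definition circle_critical :: "nat \<Rightarrow> (nat \<Rightarrow> nat \<Rightarrow> real) \<Rightarrow> (nat \<Rightarrow> complex) \<Rightarrow> bool" where
  "circle_critical n A q \<longleftrightarrow>
     (\<forall>i<n. norm (q i) = 1) \<and>
     (\<forall>i<n. circle_multiplier n A q i *\<^sub>R q i = (\<Sum>j<n. A i j *\<^sub>R q j)) \<and>
     (\<forall>x. (\<Sum>i<n. \<Sum>j<n. A i j * inner (q i) (q j) * x i * x j)
            \<le> (\<Sum>i<n. circle_multiplier n A q i * (x i)\<^sup>2))"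

lemma circle_critical_cong:
  assumes "\<And>i j. i < n \<Longrightarrow> j < n \<Longrightarrow> A i j = A' i j" "\<And>i. i < n \<Longrightarrow> q i = q' i"
  shows "circle_critical n A q \<longleftrightarrow> circle_critical n A' q'"
proof -
  have mult: "circle_multiplier n A q i = circle_multiplier n A' q' i" if "i < n" for i
    using assms that by (simp add: circle_multiplier_def)
  show ?thesis
    using assms by (simp add: circle_critical_def mult cong: sum.cong_simp)
qed

text \<open>The signs in the matrix cancel against those in the inner products, so multipliers and
  Hessian form are unchanged, while the first-order equation at i is multiplied by
  \<open>z i\<close>. This turns the planted vector z into the all-ones vector.\<close>

lemma circle_critical_gauge:
  fixes z :: "nat \<Rightarrow> real"
  assumes "circle_critical n A q" and z: "\<And>i. i < n \<Longrightarrow> (z i)\<^sup>2 = 1"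
  shows "circle_critical n (\<lambda>i j. z i * z j * A i j) (\<lambda>i. z i *\<^sub>R q i)"
proof -
  have z2: "z i * (z i * c) = c" if "i < n" for i c
    using z[OF that] by (simp add: power2_eq_square flip: mult.assoc)
  have eq: "z i * z j * A i j * inner (z i *\<^sub>R q i) (z j *\<^sub>R q j) = A i j * inner (q i) (q j)"
    if "i < n" "j < n" for i j
  proof -
    have "z i * z j * A i j * inner (z i *\<^sub>R q i) (z j *\<^sub>R q j) = (z i)\<^sup>2 * (z j)\<^sup>2 * (A i j * inner (q i) (q j))"
      by (simp add: power2_eq_square)
    then show ?thesis using z that by simp
  qed
  have mult: "circle_multiplier n (\<lambda>i j. z i * z j * A i j) (\<lambda>i. z i *\<^sub>R q i) i = circle_multiplier n A q i"
    if "i < n" for i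
    unfolding circle_multiplier_def using that by (intro sum.cong refl eq) auto
  have first: "circle_multiplier n A q i *\<^sub>R (z i *\<^sub>R q i) = (\<Sum>j<n. (z i * z j * A i j) *\<^sub>R (z j *\<^sub>R q j))"
    if "i < n" for i
  proof -
    have "(\<Sum>j<n. (z i * z j * A i j) *\<^sub>R (z j *\<^sub>R q j)) = (\<Sum>j<n. z i *\<^sub>R A i j *\<^sub>R q j)"
      by (intro sum.cong refl) (auto simp: z2 ac_simps)
    also have "\<dots> = z i *\<^sub>R (circle_multiplier n A q i *\<^sub>R q i)"
      using assms(1) that unfolding circle_critical_def by (simp add: scaleR_sum_right)
    finally show ?thesis by (simp add: ac_simps)
  qed
  have form: "(\<Sum>i<n. \<Sum>j<n. z i * z j * A i j * inner (z i *\<^sub>R q i) (z j *\<^sub>R q j) * x i * x j)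
      = (\<Sum>i<n. \<Sum>j<n. A i j * inner (q i) (q j) * x i * x j)" for x
    by (intro sum.cong refl) (simp only: eq lessThan_iff)
  have mult_form: "(\<Sum>i<n. circle_multiplier n (\<lambda>i j. z i * z j * A i j) (\<lambda>i. z i *\<^sub>R q i) i * (x i)\<^sup>2)
      = (\<Sum>i<n. circle_multiplier n A q i * (x i)\<^sup>2)" for x
    by (intro sum.cong refl) (simp only: mult lessThan_iff)
  have unit: "norm (z i *\<^sub>R q i) = 1" if "i < n" for i
    using assms(1) z[OF that] that by (auto simp: circle_critical_def power2_eq_1_iff)
  show ?thesis
    unfolding circle_critical_def form mult_form
  proof (intro conjI allI impI)
    fix x :: "nat \<Rightarrow> real"
    show "(\<Sum>i<n. \<Sum>j<n. A i j * inner (q i) (q j) * x i * x j) \<le> (\<Sum>i<n. circle_multiplier n A q i * (x i)\<^sup>2)"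
      using assms(1) by (simp add: circle_critical_def)
  qed (simp_all only: unit mult first)
qed

text \<open>The deterministic core, for the planted all-ones vector with noise E. The second-order
  condition keeps \<rho> away from 0; the first-order condition then makes \<rho> (1 - \<rho>)
  small, which forces \<rho> close to 1.\<close>

lemma circle_critical_correlation:
  fixes E :: "nat \<Rightarrow> nat \<Rightarrow> real"
  assumes n: "n \<ge> 1"
    and crit: "circle_critical n (\<lambda>i j. 1 + E i j) q"
    and diag: "\<And>i. i < n \<Longrightarrow> E i i = 0"
    and quad: "\<And>x. (\<And>i. \<bar>x i\<bar> = 1) \<Longrightarrow> \<bar>\<Sum>i<n. \<Sum>j<n. E i j * x i * x j\<bar> \<le> \<beta> * (real n)\<^sup>2"
    and lin: "\<And>x. (\<And>i. \<bar>x i\<bar> = 1) \<Longrightarrow> \<bar>\<Sum>i<n. \<Sum>j<n. E i j * x j\<bar> \<le> \<beta> * (real n)\<^sup>2"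
    and \<beta>: "\<beta> \<le> 107 / 1000"
  shows "1 - 17 / 2 * \<beta> \<le> norm (\<Sum>i<n. q i) / n"
proof -
  define N where "N = real n"
  define B where "B = \<beta> * N\<^sup>2"
  define \<rho> where "\<rho> = norm (\<Sum>i<n. q i) / N"
  have N: "N > 0" using n by (simp add: N_def)
  let ?D = "circle_multiplier n (\<lambda>i j. 1 + E i j) q"
  have unit: "norm (q i) = 1" if "i < n" for i
    using crit that by (auto simp: circle_critical_def)
  have qq: "inner (q i) (q i) = 1" if "i < n" for i
    using unit[OF that] by (simp add: dot_square_norm)
  have first: "?D i *\<^sub>R q i = (\<Sum>j<n. (1 + E i j) *\<^sub>R q j)" if "i < n" for i
    using crit that by (auto simp: circle_critical_def)
  have second: "(\<Sum>i<n. \<Sum>j<n. (1 + E i j) * inner (q i) (q j) * x i * x j) \<le> (\<Sum>i<n. ?D i * (x i)\<^sup>2)" for x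
    using crit by (auto simp: circle_critical_def)
  \<comment> \<open>The hypotheses on sign vectors extend to the cube, which contains the real
    parts, imaginary parts and projections of the unit numbers \<open>q i\<close>.\<close>
  have quad_le: "(\<Sum>i<n. \<Sum>j<n. E i j * x i * x j) \<le> B" if "\<And>i. i < n \<Longrightarrow> \<bar>x i\<bar> \<le> 1" for x
  proof (rule quadratic_form_le_on_cube)
    fix x :: "nat \<Rightarrow> real" assume "\<And>i. \<bar>x i\<bar> = 1"
    from quad[of x, OF this] show "(\<Sum>i<n. \<Sum>j<n. E i j * x i * x j) \<le> B" by (simp add: B_def N_def)
  qed (use diag that in auto)
  have quad_ge: "- B \<le> (\<Sum>i<n. \<Sum>j<n. E i j * x i * x j)" if "\<And>i. i < n \<Longrightarrow> \<bar>x i\<bar> \<le> 1" for x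
  proof -
    have "(\<Sum>i<n. \<Sum>j<n. - E i j * x i * x j) \<le> B"
    proof (rule quadratic_form_le_on_cube)
      fix x :: "nat \<Rightarrow> real" assume "\<And>i. \<bar>x i\<bar> = 1"
      from quad[of x, OF this] show "(\<Sum>i<n. \<Sum>j<n. - E i j * x i * x j) \<le> B"
        by (simp add: B_def N_def sum_negf)
    qed (use diag that in auto)
    then show ?thesis by (simp add: sum_negf)
  qed
  have lin_ge: "- B \<le> (\<Sum>i<n. \<Sum>j<n. E i j * x j)" if "\<And>i. i < n \<Longrightarrow> \<bar>x i\<bar> \<le> 1" for x
  proof -
    have "(\<Sum>i<n. \<Sum>j<n. - E i j * x j) \<le> B"
    proof (rule linear_form_le_on_cube)
      fix x :: "nat \<Rightarrow> real" assume "\<And>i. \<bar>x i\<bar> = 1"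
      from lin[of x, OF this] show "(\<Sum>i<n. \<Sum>j<n. - E i j * x j) \<le> B"
        by (simp add: B_def N_def sum_negf)
    qed (use that in auto)
    then show ?thesis by (simp add: sum_negf)
  qed
  have Re1: "\<bar>Re (q i)\<bar> \<le> 1" and Im1: "\<bar>Im (q i)\<bar> \<le> 1" if "i < n" for i
    using unit[OF that] abs_Re_le_cmod[of "q i"] abs_Im_le_cmod[of "q i"] by auto
  \<comment> \<open>The inner product is the sum of the products of real parts and of imaginary
    parts; each of the two forms costs B.\<close>
  have EX: "(\<Sum>i<n. \<Sum>j<n. E i j * inner (q i) (q j)) \<le> 2 * B"
  proof -
    have "(\<Sum>i<n. \<Sum>j<n. E i j * inner (q i) (q j))
        = (\<Sum>i<n. \<Sum>j<n. E i j * Re (q i) * Re (q j)) + (\<Sum>i<n. \<Sum>j<n. E i j * Im (q i) * Im (q j))"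
      by (simp add: inner_complex_def algebra_simps sum.distrib)
    then show ?thesis using quad_le[of "\<lambda>i. Re (q i)"] quad_le[of "\<lambda>i. Im (q i)"] Re1 Im1 by simp
  qed
  have norm_sum: "(\<Sum>i<n. \<Sum>j<n. inner (q i) (q j)) = \<rho>\<^sup>2 * N\<^sup>2"
    using N by (simp add: \<rho>_def power_divide power2_norm_eq_inner inner_sum_left inner_sum_right
        sum.swap[of "\<lambda>i j. inner (q i) (q j)"])
  have \<comment> \<open>\<open>X\<^sub>i\<^sub>j\<^sup>2 = cos\<^sup>2 (\<theta>\<^sub>i - \<theta>\<^sub>j)\<close> written with double angles\<close>
    double_angle: "(inner (q i) (q j))\<^sup>2
      = (1 + Re ((q i)\<^sup>2) * Re ((q j)\<^sup>2) + Im ((q i)\<^sup>2) * Im ((q j)\<^sup>2)) / 2" if "i < n" "j < n" for i j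
  proof -
    have "(Re (q i))\<^sup>2 + (Im (q i))\<^sup>2 = 1" "(Re (q j))\<^sup>2 + (Im (q j))\<^sup>2 = 1"
      using unit that by (simp_all flip: cmod_power2)
    then have "1 = ((Re (q i))\<^sup>2 + (Im (q i))\<^sup>2) * ((Re (q j))\<^sup>2 + (Im (q j))\<^sup>2)" by simp
    then show ?thesis
      by (simp only: inner_complex_def Re_power2 Im_power2)
         (simp add: power2_eq_square field_simps)
  qed
  have unit2: "norm ((q i)\<^sup>2) \<le> 1" if "i < n" for i
    using unit[OF that] by (simp add: norm_power)
  have Re2: "\<bar>Re ((q i)\<^sup>2)\<bar> \<le> 1" and Im2: "\<bar>Im ((q i)\<^sup>2)\<bar> \<le> 1" if "i < n" for i
    using unit2[OF that] abs_Re_le_cmod[of "(q i)\<^sup>2"] abs_Im_le_cmod[of "(q i)\<^sup>2"] by linarith+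
  \<comment> \<open>Testing on Re q and on Im q and adding gives, with X_ij the inner products, sum
    (1 + E_ij) X_ij^2 \<le> sum D_i \<le> \<rho>^2 N^2 + 2 B. On the left, the squares X_ij^2 alone
    sum to at least N^2/2 and those weighted by E to at least -3B/2.\<close>
  have rho_sq: "1 / 2 - 7 / 2 * \<beta> \<le> \<rho>\<^sup>2"
  proof -
    let ?P = "\<lambda>i. Re ((q i)\<^sup>2)" and ?R = "\<lambda>i. Im ((q i)\<^sup>2)"
    \<comment> \<open>Double angles turn the weighted sum of X_ij^2 into three forms in vectors of
      the cube: 1, Re q^2 and Im q^2. The weights are later 1 and E.\<close>
    have split: "(\<Sum>i<n. \<Sum>j<n. c i j * (inner (q i) (q j))\<^sup>2)
        = ((\<Sum>i<n. \<Sum>j<n. c i j) + (\<Sum>i<n. \<Sum>j<n. c i j * ?P i * ?P j)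
          + (\<Sum>i<n. \<Sum>j<n. c i j * ?R i * ?R j)) / 2" for c :: "nat \<Rightarrow> nat \<Rightarrow> real"
    proof -
      have "(\<Sum>i<n. \<Sum>j<n. c i j * (inner (q i) (q j))\<^sup>2)
          = (\<Sum>i<n. \<Sum>j<n. (c i j + c i j * ?P i * ?P j + c i j * ?R i * ?R j) / 2)"
        by (intro sum.cong refl) (simp add: double_angle algebra_simps add_divide_distrib)
      then show ?thesis by (simp only: sum.distrib flip: sum_divide_distrib)
    qed
    have "(\<Sum>i<n. \<Sum>j<n. (1 + E i j) * (inner (q i) (q j))\<^sup>2)
        = (\<Sum>i<n. \<Sum>j<n. (1 + E i j) * inner (q i) (q j) * Re (q i) * Re (q j))
          + (\<Sum>i<n. \<Sum>j<n. (1 + E i j) * inner (q i) (q j) * Im (q i) * Im (q j))"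
      by (simp add: inner_complex_def power2_eq_square algebra_simps flip: sum.distrib)
    also have "\<dots> \<le> (\<Sum>i<n. ?D i * (Re (q i))\<^sup>2) + (\<Sum>i<n. ?D i * (Im (q i))\<^sup>2)"
      by (intro add_mono second)
    also have "\<dots> = (\<Sum>i<n. ?D i)"
      unfolding sum.distrib[symmetric]
      by (intro sum.cong refl) (simp add: unit flip: cmod_power2 distrib_left)
    also have "\<dots> = \<rho>\<^sup>2 * N\<^sup>2 + (\<Sum>i<n. \<Sum>j<n. E i j * inner (q i) (q j))"
      by (simp add: circle_multiplier_def algebra_simps sum.distrib norm_sum)
    also have "\<dots> \<le> \<rho>\<^sup>2 * N\<^sup>2 + 2 * B" using EX by simp
    finally have "(\<Sum>i<n. \<Sum>j<n. 1 * (inner (q i) (q j))\<^sup>2) + (\<Sum>i<n. \<Sum>j<n. E i j * (inner (q i) (q j))\<^sup>2)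
        \<le> \<rho>\<^sup>2 * N\<^sup>2 + 2 * B"
      by (simp add: distrib_right sum.distrib)
    moreover have "N\<^sup>2 / 2 \<le> (\<Sum>i<n. \<Sum>j<n. 1 * (inner (q i) (q j))\<^sup>2)"
    proof -
      have "(\<Sum>i<n. \<Sum>j<n. 1 * ?P i * ?P j) = (\<Sum>i<n. ?P i)\<^sup>2" "(\<Sum>i<n. \<Sum>j<n. 1 * ?R i * ?R j) = (\<Sum>i<n. ?R i)\<^sup>2"
        unfolding power2_eq_square[of "sum _ _"] by (simp_all add: sum_product)
      then show ?thesis
        unfolding split by (simp add: N_def power2_eq_square)
    qed
    moreover have "- 3 / 2 * B \<le> (\<Sum>i<n. \<Sum>j<n. E i j * (inner (q i) (q j))\<^sup>2)"
      unfolding split using quad_ge[of ?P] quad_ge[of ?R] quad_ge[of "\<lambda>_. 1"] Re2 Im2 by simp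
    ultimately have "(1 / 2 - 7 / 2 * \<beta>) * N\<^sup>2 \<le> \<rho>\<^sup>2 * N\<^sup>2"
      by (simp add: B_def algebra_simps)
    then show ?thesis using N by simp
  qed
  have "\<rho> \<ge> 0" using N by (simp add: \<rho>_def)
  \<comment> \<open>The bound on \<beta> gives \<rho>^2 \<ge> 1/2 - 3.5 * 0.107 = 0.1255, and
    0.354^2 = 0.125316.\<close>
  have rho: "354 / 1000 \<le> \<rho>"
  proof (rule power2_le_imp_le)
    show "(354 / 1000)\<^sup>2 \<le> \<rho>\<^sup>2" 
      using rho_sq \<beta> by (simp add: power2_eq_square)
  qed fact
  \<comment> \<open>The direction e of the sum v is well defined because \<rho> is bounded away from
    0.\<close>
  define v where "v = (\<Sum>j<n. q j)"
  define e where "e = v /\<^sub>R norm v"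
  have v: "norm v = \<rho> * N" using N by (simp add: \<rho>_def v_def)
  then have v0: "norm v > 0" using N rho by simp
  have ve: "v = (\<rho> * N) *\<^sub>R e" using v0 by (simp add: e_def flip: v)
  have e: "norm e = 1" using v0 by (simp add: e_def)
  have ee: "inner e e = 1" using e by (simp add: dot_square_norm)
  have qe: "\<bar>inner (q i) e\<bar> \<le> 1" if "i < n" for i
    using Cauchy_Schwarz_ineq2[of "q i" e] e unit[OF that] by simp
  have D: "?D i \<ge> 0" if "i < n" for i
  proof -
    \<comment> \<open>On a coordinate vector the Hessian form reduces to 1 + E_ii = 1, which is
      therefore at most D_i.\<close>
    let ?u = "\<lambda>k. if k = i then 1 else 0 :: real"
    have pick: "(\<Sum>j<n. a j * ?u j) = a i" for a
    proof -
      have "(\<Sum>j<n. a j * ?u j) = (\<Sum>j<n. if j = i then a j else 0)"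
        by (intro sum.cong) auto
      then show ?thesis using that by (simp add: sum.delta)
    qed
    have "(\<Sum>k<n. \<Sum>j<n. (1 + E k j) * inner (q k) (q j) * ?u k * ?u j) = 1"
      unfolding pick using that by (simp add: diag qq)
    moreover have "(\<Sum>k<n. ?D k * (?u k)\<^sup>2) = ?D i"
      unfolding power2_eq_square by (simp add: pick flip: mult.assoc)
    ultimately show ?thesis using second[of ?u] by simp
  qed
  define g where "g i = (\<Sum>j<n. E i j *\<^sub>R q j)" for i
  have first': "?D i *\<^sub>R q i = (\<rho> * N) *\<^sub>R e + g i" if "i < n" for i
    using first[OF that] by (simp add: scaleR_add_left sum.distrib g_def flip: ve v_def)
  have \<comment> \<open>subtract the inner products of the first-order equation with \<open>e\<close> and with \<open>q i\<close>\<close>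
    defect: "\<rho> * N * (1 - inner (q i) e) \<le> inner (g i) (q i) - inner (g i) e" if "i < n" for i
  proof -
    have "?D i = \<rho> * N * inner (q i) e + inner (g i) (q i)"
      using arg_cong[OF first'[OF that], of "\<lambda>u. inner u (q i)"] that
      by (simp add: inner_add_left qq inner_commute[of e])
    moreover have "?D i * inner (q i) e = \<rho> * N + inner (g i) e"
      using arg_cong[OF first'[OF that], of "\<lambda>u. inner u e"] by (simp add: inner_add_left ee)
    moreover have "?D i * inner (q i) e \<le> ?D i"
      using mult_left_mono[of "inner (q i) e" 1 "?D i"] D[OF that] qe[OF that] by simp
    ultimately show ?thesis by (simp add: algebra_simps)
  qed
  have "(\<Sum>i<n. \<rho> * N * (1 - inner (q i) e)) = \<rho> * N * (N - inner v e)"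
    by (simp add: sum_subtractf v_def inner_sum_left N_def flip: sum_distrib_left)
  also have "inner v e = \<rho> * N" by (simp add: ve ee)
  finally have "\<rho> * N * (N - \<rho> * N) \<le> (\<Sum>i<n. inner (g i) (q i) - inner (g i) e)"
    using sum_mono[of "{..<n}" "\<lambda>i. \<rho> * N * (1 - inner (q i) e)" "\<lambda>i. inner (g i) (q i) - inner (g i) e"] defect
    by simp
  also have "\<dots> = (\<Sum>i<n. \<Sum>j<n. E i j * inner (q i) (q j)) - (\<Sum>i<n. \<Sum>j<n. E i j * inner (q j) e)"
    by (simp add: sum_subtractf g_def inner_sum_left inner_sum_right inner_commute)
  \<comment> \<open>The quadratic part costs 2 B; the second sum is the linear form of E at the
    projections of the \<open>q j\<close> onto e and costs one more B.\<close>
  also have "\<dots> \<le> 3 * B" using EX lin_ge[of "\<lambda>j. inner (q j) e"] qe by simp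
  finally have "\<rho> * (1 - \<rho>) * N\<^sup>2 \<le> 3 * \<beta> * N\<^sup>2"
    by (simp add: B_def power2_eq_square algebra_simps)
  then have fin: "\<rho> * (1 - \<rho>) \<le> 3 * \<beta>" using N by simp
  have "1 - 17 / 2 * \<beta> \<le> \<rho>"
  \<comment> \<open>If 1 - \<rho> > 8.5 \<beta>, then 0.354 (1 - \<rho>) \<le> \<rho> (1 - \<rho>)
    \<le> 3 \<beta> is violated, since 0.354 * 8.5 = 3.009 > 3 and \<beta> \<ge> 0.\<close>
  proof (rule ccontr)
    assume "\<not> ?thesis"
    then have *: "17 / 2 * \<beta> < 1 - \<rho>" by simp
    have "\<beta> \<ge> 0"
    proof -
      have "0 \<le> \<beta> * (real n)\<^sup>2" using quad[of "\<lambda>_. 1"] by (smt (verit) abs_of_pos)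
      then show ?thesis using n by (simp add: zero_le_mult_iff)
    qed
    then have "354 / 1000 * (1 - \<rho>) \<le> \<rho> * (1 - \<rho>)"
      using rho * by (intro mult_right_mono) auto
    from order_trans[OF this fin] show False using * \<open>\<beta> \<ge> 0\<close> by (simp add: field_simps)
  qed
  then show ?thesis by (simp add: \<rho>_def N_def)
qed

section \<open>Gaussian union bound\<close>

text \<open>Completing the square turns the integrand into exp (t^2 / 2) times the density of a
  normal variable with mean t.\<close>

lemma std_normal_mgf:
  "(\<integral>\<^sup>+x. ennreal (std_normal_density x) * ennreal (exp (t * x)) \<partial>lborel) = ennreal (exp (t\<^sup>2 / 2))"
proof -
  have "std_normal_density x * exp (t * x) = exp (t\<^sup>2 / 2) * normal_density t 1 x" for x
    by (simp add: normal_density_def field_simps power2_eq_square flip: exp_add)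
  then have "(\<integral>\<^sup>+x. ennreal (std_normal_density x) * ennreal (exp (t * x)) \<partial>lborel)
      = (\<integral>\<^sup>+x. ennreal (exp (t\<^sup>2 / 2)) * ennreal (normal_density t 1 x) \<partial>lborel)"
    by (simp flip: ennreal_mult)
  also have "\<dots> = ennreal (exp (t\<^sup>2 / 2)) * (\<integral>\<^sup>+x. ennreal (normal_density t 1 x) \<partial>lborel)"
    by (intro nn_integral_cmult) auto
  also have "(\<integral>\<^sup>+x. ennreal (normal_density t 1 x) \<partial>lborel) = 1"
    using prob_space.emeasure_space_1[OF prob_space_normal_density[of 1 t]]
    by (simp add: emeasure_density)
  finally show ?thesis by simp
qed

text \<open>Chernoff bound: by independence the moment generating function of the sum factors into
  Gaussian ones. Nonnegative integrals keep integrability out of the argument.\<close>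

lemma (in prob_space) std_normal_sum_tail:
  assumes "finite I" and indep: "indep_vars (\<lambda>_. borel) X I"
    and normal: "\<And>i. i \<in> I \<Longrightarrow> distributed M lborel (X i) std_normal_density"
    and v: "(\<Sum>i\<in>I. (c i)\<^sup>2) \<le> v" and "v > 0" "s > 0"
  shows "prob {\<omega> \<in> space M. s \<le> (\<Sum>i\<in>I. c i * X i \<omega>)} \<le> exp (- (s\<^sup>2 / (2 * v)))"
proof -
  have [measurable]: "X i \<in> borel_measurable M" if "i \<in> I" for i
    using normal[OF that] by (simp add: distributed_def)
  \<comment> \<open>This t minimises the Chernoff exponent t^2 v / 2 - t s, with minimum -s^2 / (2
    v).\<close>
  define t where "t = s / v"
  have "t > 0" using assms by (simp add: t_def)
  let ?S = "\<lambda>\<omega>. \<Sum>i\<in>I. c i * X i \<omega>"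
  have "indep_vars (\<lambda>_. borel) (\<lambda>i \<omega>. exp (t * c i * X i \<omega>)) I"
    by (rule indep_vars_compose2[OF indep, where Y = "\<lambda>i x. exp (t * c i * x)"]) simp
  then have indep': "indep_vars (\<lambda>_. borel) (\<lambda>i \<omega>. ennreal (exp (t * c i * X i \<omega>))) I"
    by (rule indep_vars_compose2[where Y = "\<lambda>i x. ennreal x"]) simp
  have "(\<integral>\<^sup>+\<omega>. ennreal (exp (t * ?S \<omega>)) \<partial>M) = (\<integral>\<^sup>+\<omega>. (\<Prod>i\<in>I. ennreal (exp (t * c i * X i \<omega>))) \<partial>M)"
    using \<open>finite I\<close> by (simp add: sum_distrib_left exp_sum prod_ennreal mult.assoc)
  also have "\<dots> = (\<Prod>i\<in>I. \<integral>\<^sup>+\<omega>. ennreal (exp (t * c i * X i \<omega>)) \<partial>M)"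
    by (rule indep_vars_nn_integral[OF \<open>finite I\<close> indep']) simp
  also have "\<dots> = (\<Prod>i\<in>I. ennreal (exp ((t * c i)\<^sup>2 / 2)))"
  proof (intro prod.cong refl)
    fix i assume "i \<in> I"
    from distributed_nn_integral[OF normal[OF this], of "\<lambda>x. ennreal (exp (t * c i * x))"]
    show "(\<integral>\<^sup>+\<omega>. ennreal (exp (t * c i * X i \<omega>)) \<partial>M) = ennreal (exp ((t * c i)\<^sup>2 / 2))"
      by (simp add: std_normal_mgf)
  qed
  also have "\<dots> = ennreal (exp (t\<^sup>2 / 2 * (\<Sum>i\<in>I. (c i)\<^sup>2)))"
    using \<open>finite I\<close> by (simp add: prod_ennreal power_mult_distrib exp_sum sum_distrib_left)
  also have "\<dots> \<le> ennreal (exp (t\<^sup>2 / 2 * v))"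
    using v by (intro ennreal_leI) (auto intro!: mult_left_mono)
  finally have mgf: "(\<integral>\<^sup>+\<omega>. ennreal (exp (t * ?S \<omega>)) \<partial>M) \<le> ennreal (exp (t\<^sup>2 / 2 * v))" .
  have "emeasure M {\<omega> \<in> space M. s \<le> ?S \<omega>} \<le> ennreal (exp (- t * s)) * (\<integral>\<^sup>+\<omega>. ennreal (exp (t * ?S \<omega>)) \<partial>M)"
    using Chernoff_ineq_nn_integral_ge[of t "space M" M ?S s] \<open>t > 0\<close> by simp
  also have "\<dots> \<le> ennreal (exp (- t * s)) * ennreal (exp (t\<^sup>2 / 2 * v))"
    by (intro mult_left_mono mgf) simp
  also have "\<dots> = ennreal (exp (- (s\<^sup>2 / (2 * v))))"
    using \<open>v > 0\<close> by (simp add: t_def power2_eq_square field_simps flip: ennreal_mult exp_add)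
  finally show ?thesis by (simp add: emeasure_eq_measure)
qed

lemma (in prob_space) std_normal_sum_tail_abs:
  assumes "finite I" and indep: "indep_vars (\<lambda>_. borel) X I"
    and normal: "\<And>i. i \<in> I \<Longrightarrow> distributed M lborel (X i) std_normal_density"
    and v: "(\<Sum>i\<in>I. (c i)\<^sup>2) \<le> v" and "v > 0" "s > 0"
  shows "prob {\<omega> \<in> space M. s \<le> \<bar>\<Sum>i\<in>I. c i * X i \<omega>\<bar>} \<le> 2 * exp (- (s\<^sup>2 / (2 * v)))"
proof -
  have [measurable]: "X i \<in> borel_measurable M" if "i \<in> I" for i
    using normal[OF that] by (simp add: distributed_def)
  let ?T = "\<lambda>c. {\<omega> \<in> space M. s \<le> (\<Sum>i\<in>I. c i * X i \<omega>)}"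
  have "{\<omega> \<in> space M. s \<le> \<bar>\<Sum>i\<in>I. c i * X i \<omega>\<bar>} = ?T c \<union> ?T (\<lambda>i. - c i)"
    by (auto simp: sum_negf abs_if split: if_splits)
  moreover have "prob (?T c \<union> ?T (\<lambda>i. - c i)) \<le> prob (?T c) + prob (?T (\<lambda>i. - c i))"
    by (intro measure_Un_le) measurable
  moreover have "prob (?T c) \<le> exp (- (s\<^sup>2 / (2 * v)))" "prob (?T (\<lambda>i. - c i)) \<le> exp (- (s\<^sup>2 / (2 * v)))"
    using assms by (intro std_normal_sum_tail; simp)+
  ultimately show ?thesis by simp
qed

text \<open>Only the entries below the diagonal are independent, so the form is rewritten as a
  linear combination of these before the tail bound is applied.\<close>

lemma bilinear_form_below_diagonal:
  fixes w :: "nat \<Rightarrow> nat \<Rightarrow> real"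
  assumes sym: "\<And>i j. i < n \<Longrightarrow> j < n \<Longrightarrow> w i j = w j i" and diag: "\<And>i. i < n \<Longrightarrow> w i i = 0"
  shows "(\<Sum>i<n. \<Sum>j<n. w i j * y i * x j)
    = (\<Sum>(i, j)\<in>{(i, j). j < i \<and> i < n}. (y i * x j + y j * x i) * w i j)"
proof -
  have "(\<Sum>(i, j)\<in>{(i, j). j < i \<and> i < n}. f i j) = (\<Sum>i<n. \<Sum>j<i. f i j)" for f :: "nat \<Rightarrow> nat \<Rightarrow> real"
    by (subst sum.Sigma) (auto intro!: sum.cong)
  \<comment> \<open>Induction over the leading m by m corners: each step adds one row and one
    column, which agree by symmetry of w.\<close>
  moreover have "(\<Sum>i<m. \<Sum>j<m. w i j * y i * x j) = (\<Sum>i<m. \<Sum>j<i. (y i * x j + y j * x i) * w i j)"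
    if "m \<le> n" for m
    using that
  proof (induction m)
    case (Suc m)
    have "(\<Sum>i<m. w i m * y i * x m) = (\<Sum>j<m. y j * x m * w m j)"
      using Suc.prems by (intro sum.cong refl) (simp add: sym[of _ m])
    moreover have "(\<Sum>j<m. w m j * y m * x j) = (\<Sum>j<m. y m * x j * w m j)"
      by (simp add: ac_simps)
    ultimately show ?case
      using Suc diag[of m] by (simp add: sum.distrib algebra_simps)
  qed simp
  ultimately show ?thesis by simp
qed

definition bilinear_form :: "nat \<Rightarrow> real mat \<Rightarrow> (nat \<Rightarrow> real) \<Rightarrow> (nat \<Rightarrow> real) \<Rightarrow> real" where
  "bilinear_form n A y x = (\<Sum>i<n. \<Sum>j<n. A $$ (i, j) * y i * x j)"

text \<open>The coefficients have squares at most 4 and there are at most n^2 / 2 of them, so the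
  form is a Gaussian sum of variance at most 2 n^2.\<close>

lemma gaussian_wigner_form_tail:
  assumes "prob_space M" and W: "gaussian_wigner M n W" and "n \<ge> 1" "s > 0"
    and x: "\<And>i. i < n \<Longrightarrow> \<bar>x i\<bar> = 1" and y: "\<And>i. i < n \<Longrightarrow> \<bar>y i\<bar> = 1"
  shows "{\<omega> \<in> space M. s \<le> \<bar>bilinear_form n (W \<omega>) y x\<bar>} \<in> sets M" (is "?A \<in> _")
    and "measure M {\<omega> \<in> space M. s \<le> \<bar>bilinear_form n (W \<omega>) y x\<bar>} \<le> 2 * exp (- (s\<^sup>2 / (4 * (real n)\<^sup>2)))"
proof -
  interpret prob_space M by fact
  define I where "I = {(i, j). j < i \<and> i < n}"
  have I: "I \<subseteq> {..<n} \<times> {..<n}" by (auto simp: I_def)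
  then have fin: "finite I" by (rule finite_subset) auto
  define c where "c = (\<lambda>(i, j). y i * x j + y j * x i)"
  have form: "bilinear_form n (W \<omega>) y x = (\<Sum>p\<in>I. c p * W \<omega> $$ p)" if "\<omega> \<in> space M" for \<omega>
  proof -
    have W\<omega>: "W \<omega> \<in> carrier_mat n n" "(W \<omega>)\<^sup>T = W \<omega>" "\<And>i. i < n \<Longrightarrow> W \<omega> $$ (i, i) = 0"
      using W that by (auto simp: gaussian_wigner_def)
    have "W \<omega> $$ (i, j) = W \<omega> $$ (j, i)" if "i < n" "j < n" for i j
      using W\<omega>(1,2) that by (metis carrier_matD index_transpose_mat(1))
    then show ?thesis
      using W\<omega>(3) unfolding bilinear_form_def I_def c_def
      by (subst bilinear_form_below_diagonal) (auto intro!: sum.cong)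
  qed
  have eq: "?A = {\<omega> \<in> space M. s \<le> \<bar>\<Sum>p\<in>I. c p * W \<omega> $$ p\<bar>}"
    using form by auto
  have normal: "distributed M lborel (\<lambda>\<omega>. W \<omega> $$ p) std_normal_density" if "p \<in> I" for p
    using W that by (auto simp: gaussian_wigner_def I_def)
  then have [measurable]: "(\<lambda>\<omega>. W \<omega> $$ p) \<in> borel_measurable M" if "p \<in> I" for p
    using that by (simp add: distributed_def)
  show "?A \<in> sets M" unfolding eq by measurable
  have "(\<Sum>p\<in>I. (c p)\<^sup>2) \<le> 2 * (real n)\<^sup>2"
  proof -
    have "(c p)\<^sup>2 \<le> 4" if p_in: "p \<in> I" for p
    proof -
      obtain i j where p: "p = (i, j)" "i < n" "j < n" using p_in by (auto simp: I_def)
      have "\<bar>c p\<bar> \<le> \<bar>y i * x j\<bar> + \<bar>y j * x i\<bar>" by (simp add: c_def p)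
      also have "\<dots> = 2" using x y p by (simp add: abs_mult)
      finally show ?thesis using abs_le_square_iff[of "c p" 2] by simp
    qed
    then have "(\<Sum>p\<in>I. (c p)\<^sup>2) \<le> 4 * real (card I)"
      using sum_bounded_above[of I "\<lambda>p. (c p)\<^sup>2" 4] by (simp add: ac_simps)
    \<comment> \<open>The strict lower triangle and its mirror image are disjoint inside the n by n
      square.\<close>
    moreover have "2 * card I \<le> n * n"
    proof -
      have "I \<inter> prod.swap ` I = {}" by (auto simp: I_def)
      then have "card (I \<union> prod.swap ` I) = card I + card I"
        using fin by (subst card_Un_disjoint) (auto simp: card_image)
      moreover have "card (I \<union> prod.swap ` I) \<le> card ({..<n} \<times> {..<n})"
        using I by (intro card_mono) auto
      ultimately show ?thesis by simp
    qed
    then have "2 * real (card I) \<le> (real n)\<^sup>2"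
      by (metis of_nat_le_iff of_nat_mult of_nat_numeral power2_eq_square)
    ultimately show ?thesis by linarith
  qed
  moreover have "indep_vars (\<lambda>_. borel) (\<lambda>p \<omega>. W \<omega> $$ p) I"
    using W by (simp add: gaussian_wigner_def I_def)
  ultimately show "measure M ?A \<le> 2 * exp (- (s\<^sup>2 / (4 * (real n)\<^sup>2)))"
    unfolding eq using std_normal_sum_tail_abs[OF fin, of "\<lambda>p \<omega>. W \<omega> $$ p" c "2 * (real n)\<^sup>2" s] normal assms(3,4)
    by simp
qed

text \<open>Extensional functions, so that the set is finite with 2^n elements and a union bound is
  possible.\<close>

definition sign_vectors :: "nat \<Rightarrow> (nat \<Rightarrow> real) set" where
  "sign_vectors n = {..<n} \<rightarrow>\<^sub>E {-1, 1}"

lemma finite_sign_vectors [simp]: "finite (sign_vectors n)"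
  by (simp add: sign_vectors_def finite_PiE)

lemma card_sign_vectors: "card (sign_vectors n) = 2 ^ n"
  by (simp add: sign_vectors_def card_PiE numeral_2_eq_2)

text \<open>The good event. The left argument is x itself or the fixed y, never a second free sign
  vector, so the union bound runs over 2^n rather than 4^n choices.\<close>

definition forms_bounded :: "nat \<Rightarrow> (nat \<Rightarrow> real) \<Rightarrow> real \<Rightarrow> real mat \<Rightarrow> bool" where
  "forms_bounded n y s A \<longleftrightarrow>
     (\<forall>x\<in>sign_vectors n. \<bar>bilinear_form n A x x\<bar> < s \<and> \<bar>bilinear_form n A y x\<bar> < s)"

text \<open>Union bound: the factor 4 counts two forms for each sign vector, each with a two-sided
  tail.\<close>

lemma gaussian_wigner_forms_bounded:
  assumes "prob_space M" and W: "gaussian_wigner M n W" and "n \<ge> 1" "s > 0"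
    and y: "\<And>i. i < n \<Longrightarrow> \<bar>y i\<bar> = 1"
  shows "1 - 4 * 2 ^ n * exp (- (s\<^sup>2 / (4 * (real n)\<^sup>2))) \<le> measure M {\<omega> \<in> space M. forms_bounded n y s (W \<omega>)}"
proof -
  interpret prob_space M by fact
  let ?B = "\<lambda>y x. {\<omega> \<in> space M. s \<le> \<bar>bilinear_form n (W \<omega>) y x\<bar>}"
  let ?p = "exp (- (s\<^sup>2 / (4 * (real n)\<^sup>2)))"
  have x: "\<bar>x i\<bar> = 1" if "x \<in> sign_vectors n" "i < n" for x i
    using that by (auto simp: sign_vectors_def PiE_iff dest!: bspec[of _ _ i])
  define B where "B = (\<Union>x\<in>sign_vectors n. ?B x x \<union> ?B y x)"
  note tail = gaussian_wigner_form_tail[OF assms(1-4)]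
  have sets: "?B x x \<union> ?B y x \<in> sets M" if "x \<in> sign_vectors n" for x
    using that by (intro sets.Un tail x y)
  then have "B \<in> sets M" unfolding B_def by (intro sets.finite_UN) auto
  have eq: "{\<omega> \<in> space M. forms_bounded n y s (W \<omega>)} = space M - B"
    by (auto simp: B_def forms_bounded_def not_le)
  have "prob B \<le> (\<Sum>x\<in>sign_vectors n. prob (?B x x \<union> ?B y x))"
    unfolding B_def using sets by (intro finite_measure_subadditive_finite) auto
  also have "\<dots> \<le> (\<Sum>x\<in>sign_vectors n. 4 * ?p)"
  proof (intro sum_mono)
    fix x assume "x \<in> sign_vectors n"
    note x = x[OF this]
    have "prob (?B x x \<union> ?B y x) \<le> prob (?B x x) + prob (?B y x)"
      by (intro measure_Un_le tail x y)
    also have "\<dots> \<le> 2 * ?p + 2 * ?p" by (intro add_mono tail x y)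
    finally show "prob (?B x x \<union> ?B y x) \<le> 4 * ?p" by simp
  qed
  also have "\<dots> = 4 * 2 ^ n * ?p" by (simp add: card_sign_vectors)
  finally show "1 - 4 * 2 ^ n * ?p \<le> measure M {\<omega> \<in> space M. forms_bounded n y s (W \<omega>)}"
    unfolding eq using \<open>B \<in> sets M\<close> by (simp add: prob_compl)
qed

section \<open>Two-column matrices as points on products of circles\<close>

definition row_circle :: "real mat \<Rightarrow> nat \<Rightarrow> complex" where
  "row_circle Q i = Complex (Q $$ (i, 0)) (Q $$ (i, 1))"

text \<open>\<open>Q * Q\<^sup>T\<close> is the Gram matrix of the rows, and the two columns of the
  first-order condition are the real and imaginary parts of one complex equation. Symmetry of A
  yields the symmetry demanded by \<open>psd_mat\<close>, which leaves only the inequality.\<close>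

lemma second_order_critical_point_iff_circle_critical:
  assumes A: "A \<in> carrier_mat n n" "A\<^sup>T = A" and Q: "Q \<in> carrier_mat n 2"
  shows "second_order_critical_point n A Q \<longleftrightarrow> circle_critical n (\<lambda>i j. A $$ (i, j)) (row_circle Q)"
proof -
  let ?q = "row_circle Q" and ?A = "\<lambda>i j. A $$ (i, j)"
  let ?D = "circle_multiplier n ?A ?q"
  define G where "G = ddiag (A * Q * Q\<^sup>T)"
  define S where "S = G - A \<circ>\<^sub>m (Q * Q\<^sup>T)"
  have A_sym: "A $$ (i, j) = A $$ (j, i)" if "i < n" "j < n" for i j
    using A that by (metis carrier_matD index_transpose_mat(1))
  have two: "{0..<2} = {0, 1::nat}" by auto
  have gram: "(Q * Q\<^sup>T) $$ (i, j) = inner (?q i) (?q j)" if "i < n" "j < n" for i j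
    using Q that by (simp add: scalar_prod_def row_circle_def inner_complex_def two)
  have AQ: "(A * Q) $$ (i, k) = (\<Sum>j<n. A $$ (i, j) * Q $$ (j, k))" if "i < n" "k < 2" for i k
    using A Q that by (simp add: scalar_prod_def atLeast0LessThan)
  have mult: "(A * Q * Q\<^sup>T) $$ (i, i) = ?D i" if "i < n" for i
  proof -
    have "(A * Q * Q\<^sup>T) $$ (i, i) = (A * (Q * Q\<^sup>T)) $$ (i, i)"
      using A Q by (simp add: assoc_mult_mat[of _ n n _ 2 _ n])
    also have "\<dots> = (\<Sum>j<n. A $$ (i, j) * (Q * Q\<^sup>T) $$ (j, i))"
      using A Q that by (simp add: scalar_prod_def[of "row A i"] atLeast0LessThan)
    finally show ?thesis
      using that by (simp add: circle_multiplier_def gram inner_commute)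
  qed
  have ddiag: "G \<in> carrier_mat n n"
    using A Q by (simp add: G_def ddiag_def)
  have ddiag_index: "G $$ (i, j) = (if i = j then ?D i else 0)" if "i < n" "j < n" for i j
    using A Q that mult by (simp add: G_def ddiag_def mat_diag_def)
  have feasible: "feasible n Q \<longleftrightarrow> (\<forall>i<n. norm (?q i) = 1)"
  proof -
    have "(l2_norm_vec (row Q i))\<^sup>2 = (norm (?q i))\<^sup>2" if "i < n" for i
      using Q that by (simp add: l2_norm_vec_def L2_set_def row_circle_def sum_nonneg cmod_power2
          lessThan_atLeast0 two)
    then show ?thesis
      using Q by (auto simp: feasible_def power2_eq_1_iff)
        (smt (verit) norm_ge_zero)
  qed
  have first: "(G - A) * Q = 0\<^sub>m n 2 \<longleftrightarrow>
      (\<forall>i<n. ?D i *\<^sub>R ?q i = (\<Sum>j<n. A $$ (i, j) *\<^sub>R ?q j))"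
  proof -
    have entry: "((G - A) * Q) $$ (i, k) = ?D i * Q $$ (i, k) - (\<Sum>j<n. A $$ (i, j) * Q $$ (j, k))"
      if "i < n" "k < 2" for i k
    proof -
      have "((G - A) * Q) $$ (i, k)
          = (\<Sum>j<n. ((if i = j then ?D i else 0) - A $$ (i, j)) * Q $$ (j, k))"
        using A Q ddiag that by (simp add: scalar_prod_def atLeast0LessThan ddiag_index)
      also have "\<dots> = (\<Sum>j<n. (if i = j then ?D i * Q $$ (i, k) else 0) - A $$ (i, j) * Q $$ (j, k))"
        by (intro sum.cong) (auto simp: left_diff_distrib)
      finally show ?thesis using that by (simp add: sum_subtractf)
    qed
    have carrier: "(G - A) * Q \<in> carrier_mat n 2"
      using A Q ddiag by auto
    have "(G - A) * Q = 0\<^sub>m n 2 \<longleftrightarrow>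
        (\<forall>i<n. \<forall>k<2. ?D i * Q $$ (i, k) = (\<Sum>j<n. A $$ (i, j) * Q $$ (j, k)))"
    proof
      assume "(G - A) * Q = 0\<^sub>m n 2"
      then show "\<forall>i<n. \<forall>k<2. ?D i * Q $$ (i, k) = (\<Sum>j<n. A $$ (i, j) * Q $$ (j, k))"
        using entry by auto
    next
      assume "\<forall>i<n. \<forall>k<2. ?D i * Q $$ (i, k) = (\<Sum>j<n. A $$ (i, j) * Q $$ (j, k))"
      then show "(G - A) * Q = 0\<^sub>m n 2"
        using entry carrier by (intro eq_matI) auto
    qed
    also have "\<dots> \<longleftrightarrow> (\<forall>i<n. ?D i *\<^sub>R ?q i = (\<Sum>j<n. A $$ (i, j) *\<^sub>R ?q j))"
      by (auto simp: complex_eq_iff row_circle_def less_2_cases_iff)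
    finally show ?thesis .
  qed
  have S: "S \<in> carrier_mat n n"
    using A ddiag by (auto simp: S_def hadamard_def)
  have S_index: "S $$ (i, j) = (if i = j then ?D i else 0) - A $$ (i, j) * inner (?q i) (?q j)"
    if "i < n" "j < n" for i j
    using A Q that ddiag by (simp add: S_def hadamard_def ddiag_index gram del: index_mult_mat)
  have S_sym: "S\<^sup>T = S"
    using S by (intro eq_matI) (auto simp: S_index inner_commute A_sym)
  have S_form: "x \<bullet> (S *\<^sub>v x) = (\<Sum>i<n. ?D i * (x $ i)\<^sup>2) - (\<Sum>i<n. \<Sum>j<n. A $$ (i, j) * inner (?q i) (?q j) * x $ i * x $ j)"
    if "x \<in> carrier_vec n" for x
  proof -
    have "x \<bullet> (S *\<^sub>v x) = (\<Sum>i<n. \<Sum>j<n. x $ i * (S $$ (i, j) * x $ j))"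
      using S that by (simp add: scalar_prod_def atLeast0LessThan sum_distrib_left)
    also have "\<dots> = (\<Sum>i<n. \<Sum>j<n. (if i = j then ?D i * (x $ i)\<^sup>2 else 0) - A $$ (i, j) * inner (?q i) (?q j) * x $ i * x $ j)"
      by (intro sum.cong refl) (auto simp: S_index algebra_simps power2_eq_square)
    finally show ?thesis by (simp add: sum_subtractf)
  qed
  have second: "psd_mat n S \<longleftrightarrow> (\<forall>x. (\<Sum>i<n. \<Sum>j<n. A $$ (i, j) * inner (?q i) (?q j) * x i * x j)
            \<le> (\<Sum>i<n. ?D i * (x i)\<^sup>2))" (is "_ \<longleftrightarrow> (\<forall>x. ?le x)")
  proof
    assume psd: "psd_mat n S"
    show "\<forall>x. ?le x"
    proof
      fix x :: "nat \<Rightarrow> real"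
      have "0 \<le> vec n x \<bullet> (S *\<^sub>v vec n x)" using psd by (simp add: psd_mat_def)
      then show "?le x" by (simp add: S_form)
    qed
  next
    assume "\<forall>x. ?le x"
    then show "psd_mat n S" using S S_sym by (auto simp: psd_mat_def S_form)
  qed
  show ?thesis
    unfolding second_order_critical_point_def circle_critical_def feasible G_def[symmetric] S_def[symmetric] first second by blast
qed

lemma l2_norm_transpose_mult:
  assumes "Q \<in> carrier_mat n 2" "z \<in> carrier_vec n"
  shows "l2_norm_vec (Q\<^sup>T *\<^sub>v z) = norm (\<Sum>i<n. z $ i *\<^sub>R row_circle Q i)"
proof -
  have two: "{..<2} = {0, 1::nat}" by auto
  have "(Q\<^sup>T *\<^sub>v z) $ k = (\<Sum>i<n. z $ i * Q $$ (i, k))" if "k < 2" for k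
    using assms that by (simp add: scalar_prod_def atLeast0LessThan mult.commute)
  then show ?thesis
    using assms by (simp add: l2_norm_vec_def L2_set_def cmod_def row_circle_def two)
qed

text \<open>Moves the quantifier from matrices to sequences of unit complex numbers, which form a
  compact set; measurability rests on this.\<close>

lemma all_critical_points_iff:
  assumes A: "A \<in> carrier_mat n n" "A\<^sup>T = A" and z: "z \<in> carrier_vec n"
  shows "(\<forall>Q. second_order_critical_point n A Q \<longrightarrow> l2_norm_vec (Q\<^sup>T *\<^sub>v z) / real n \<ge> c) \<longleftrightarrow>
    (\<forall>q. (\<forall>i. norm (q i) = 1) \<longrightarrow> circle_critical n (\<lambda>i j. A $$ (i, j)) q \<longrightarrow>
       norm (\<Sum>i<n. z $ i *\<^sub>R q i) / real n \<ge> c)" (is "?L \<longleftrightarrow> ?R")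
proof
  assume L: ?L
  show ?R
  proof (intro allI impI)
    fix q assume crit: "circle_critical n (\<lambda>i j. A $$ (i, j)) q"
    define Q where "Q = mat n 2 (\<lambda>(i, j). if j = 0 then Re (q i) else Im (q i))"
    have Q: "Q \<in> carrier_mat n 2" by (simp add: Q_def)
    have q: "row_circle Q i = q i" if "i < n" for i
      using that by (simp add: Q_def row_circle_def)
    have "second_order_critical_point n A Q"
      using crit by (simp add: second_order_critical_point_iff_circle_critical[OF A Q] q cong: circle_critical_cong)
    then show "norm (\<Sum>i<n. z $ i *\<^sub>R q i) / real n \<ge> c"
      using L by (auto simp: l2_norm_transpose_mult[OF Q z] q)
  qed
next
  assume R: ?R
  show ?L
  proof (intro allI impI)
    fix Q assume soc: "second_order_critical_point n A Q"
    then have Q: "Q \<in> carrier_mat n 2" by (simp add: second_order_critical_point_def feasible_def)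
    \<comment> \<open>The default 1 keeps the coordinates from \<open>n\<close> on on the unit
      circle.\<close>
    define q where "q i = (if i < n then row_circle Q i else 1)" for i
    have crit: "circle_critical n (\<lambda>i j. A $$ (i, j)) q"
      using soc by (simp add: second_order_critical_point_iff_circle_critical[OF A Q] q_def cong: circle_critical_cong)
    moreover have "norm (q i) = 1" for i
      using crit by (cases "i < n") (auto simp: circle_critical_def q_def)
    ultimately have "norm (\<Sum>i<n. z $ i *\<^sub>R q i) / real n \<ge> c" using R by blast
    then show "l2_norm_vec (Q\<^sup>T *\<^sub>v z) / real n \<ge> c"
      by (simp add: l2_norm_transpose_mult[OF Q z] q_def)
  qed
qed

section \<open>Measurability\<close>

text \<open>Projection along a compact factor is a closed map.\<close>

lemma closed_Collect_bex_compact: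
  fixes K :: "'a::topological_space set" and T :: "('a \<times> 'b::topological_space) set"
  assumes "compact K" "closed T"
  shows "closed {y. \<exists>x\<in>K. (x, y) \<in> T}"
proof -
  have "compact_space (top_of_set K)"
    using assms(1) by (simp add: compact_space_subtopology)
  then have "closed_map (prod_topology (top_of_set K) euclidean) (euclidean :: 'b topology) snd"
    by (rule Abstract_Topological_Spaces.closed_map_snd)
  moreover have "prod_topology (top_of_set K) (euclidean :: 'b topology) = top_of_set (K \<times> UNIV)"
    using prod_topology_subtopology(1)[of euclidean K "euclidean :: 'b topology"] by simp
  moreover have "closedin (top_of_set (K \<times> (UNIV :: 'b set))) (K \<times> UNIV \<inter> T)"
    using assms(2) by (rule closedin_closed_Int)
  ultimately have "closed (snd ` (K \<times> UNIV \<inter> T))"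
    unfolding closed_map_def closed_closedin by metis
  moreover have "snd ` (K \<times> UNIV \<inter> T) = {y. \<exists>x\<in>K. (x, y) \<in> T}"
    by (force simp: image_iff)
  ultimately show ?thesis by simp
qed

lemma borel_Collect_bex_compact_less:
  fixes K :: "'a::topological_space set" and T :: "('a \<times> 'b::topological_space) set"
  assumes "compact K" "closed T" "continuous_on UNIV h"
  shows "{y. \<exists>x\<in>K. (x, y) \<in> T \<and> h (x, y) < (c::real)} \<in> sets borel"
proof -
  \<comment> \<open>The strict inequality is a countable union of the closed conditions
    \<open>h p \<le> c - 1 / (k + 1)\<close>, and each projects to a closed set.\<close>
  let ?C = "\<lambda>k. {y. \<exists>x\<in>K. (x, y) \<in> T \<inter> {p. h p \<le> c - inverse (real (Suc k))}}"
  have "{y. \<exists>x\<in>K. (x, y) \<in> T \<and> h (x, y) < c} = (\<Union>k. ?C k)"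
  proof (intro equalityI subsetI)
    fix y assume "y \<in> {y. \<exists>x\<in>K. (x, y) \<in> T \<and> h (x, y) < c}"
    then obtain x where x: "x \<in> K" "(x, y) \<in> T" "h (x, y) < c" by auto
    then obtain k where "inverse (real (Suc k)) < c - h (x, y)"
      using reals_Archimedean[of "c - h (x, y)"] by auto
    then have "y \<in> ?C k" using x by (auto intro!: bexI[of _ x])
    then show "y \<in> (\<Union>k. ?C k)" by blast
  next
    fix y assume "y \<in> (\<Union>k. ?C k)"
    then obtain k x where x: "x \<in> K" "(x, y) \<in> T" "h (x, y) \<le> c - inverse (real (Suc k))" by auto
    moreover have "inverse (real (Suc k)) > 0" by simp
    ultimately have "h (x, y) < c" by linarith
    with x show "y \<in> {y. \<exists>x\<in>K. (x, y) \<in> T \<and> h (x, y) < c}" by auto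
  qed
  moreover have "closed (?C k)" for k
    using assms by (intro closed_Collect_bex_compact closed_Int closed_Collect_le continuous_on_const)
  ultimately show ?thesis by (simp add: sets.countable_UN borel_closed)
qed

text \<open>Tychonoff's theorem for a countable product of circles.\<close>

lemma compact_unit_modulus: "compact {q :: nat \<Rightarrow> complex. \<forall>i. norm (q i) = 1}"
proof -
  have "compactin (product_topology (\<lambda>_. euclidean) UNIV) ((UNIV :: nat set) \<rightarrow>\<^sub>E sphere (0::complex) 1)"
    by (simp add: compactin_PiE)
  moreover have "(UNIV :: nat set) \<rightarrow>\<^sub>E sphere (0::complex) 1 = {q. \<forall>i. norm (q i) = 1}"
    by (auto simp: PiE_iff)
  ultimately show ?thesis
    by (simp add: euclidean_product_topology)
qed

text \<open>For each fixed test vector x the conditions are equations and weak inequalities between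
  continuous functions of finitely many coordinates; quantifying over all x intersects closed
  sets.\<close>

lemma closed_circle_critical:
  "closed {p. circle_critical n (\<lambda>i j. snd p (i, j)) (fst p)}"
proof -
  have [continuous_intros]: "continuous_on UNIV (\<lambda>p :: (nat \<Rightarrow> complex) \<times> (nat \<times> nat \<Rightarrow> real). fst p i)" for i
    by (rule continuous_on_product_then_coordinatewise[OF continuous_on_fst[OF continuous_on_id]])
  have [continuous_intros]: "continuous_on UNIV (\<lambda>p :: (nat \<Rightarrow> complex) \<times> (nat \<times> nat \<Rightarrow> real). snd p i)" for i
    by (rule continuous_on_product_then_coordinatewise[OF continuous_on_snd[OF continuous_on_id]])
  show ?thesis
    unfolding circle_critical_def circle_multiplier_def
    by (intro closed_Collect_conj closed_Collect_all closed_Collect_imp closed_Collect_eq closed_Collect_le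
        open_Collect_const continuous_intros)
qed

lemma sets_all_critical:
  fixes A :: "'w \<Rightarrow> nat \<Rightarrow> nat \<Rightarrow> real" and z :: "nat \<Rightarrow> real"
  assumes [measurable]: "\<And>i j. i < n \<Longrightarrow> j < n \<Longrightarrow> (\<lambda>\<omega>. A \<omega> i j) \<in> borel_measurable M"
  shows "{\<omega> \<in> space M. \<forall>q. (\<forall>i. norm (q i) = 1) \<longrightarrow> circle_critical n (A \<omega>) q \<longrightarrow>
       norm (\<Sum>i<n. z i *\<^sub>R q i) / real n \<ge> c} \<in> sets M"
proof -
  let ?K = "{q :: nat \<Rightarrow> complex. \<forall>i. norm (q i) = 1}"
  let ?T = "{p. circle_critical n (\<lambda>i j. snd p (i, j)) (fst p)}"
  define h where "h p = norm (\<Sum>i<n. z i *\<^sub>R fst p i) / real n" for p :: "(nat \<Rightarrow> complex) \<times> (nat \<times> nat \<Rightarrow> real)"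
  \<comment> \<open>Zero outside the n by n block makes every coordinate measurable, hence also F as
    a map into the full product space.\<close>
  define F where "F \<omega> = (\<lambda>(i, j). if i < n \<and> j < n then A \<omega> i j else 0)" for \<omega>
  have F: "F \<in> borel_measurable M"
  proof (rule measurable_coordinatewise_then_product)
    fix p :: "nat \<times> nat"
    show "(\<lambda>\<omega>. F \<omega> p) \<in> borel_measurable M"
      by (cases p; cases "fst p < n \<and> snd p < n") (auto simp: F_def)
  qed
  have "continuous_on UNIV (\<lambda>p :: (nat \<Rightarrow> complex) \<times> (nat \<times> nat \<Rightarrow> real). fst p i)" for i
    by (rule continuous_on_product_then_coordinatewise[OF continuous_on_fst[OF continuous_on_id]])
  then have "continuous_on UNIV h"
    unfolding h_def divide_inverse by (intro continuous_intros)
  then have "{w. \<exists>q\<in>?K. (q, w) \<in> ?T \<and> h (q, w) < c} \<in> sets borel"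
    by (intro borel_Collect_bex_compact_less compact_unit_modulus closed_circle_critical)
  then have "F -` {w. \<exists>q\<in>?K. (q, w) \<in> ?T \<and> h (q, w) < c} \<inter> space M \<in> sets M"
    by (rule measurable_sets[OF F])
  moreover have "circle_critical n (\<lambda>i j. F \<omega> (i, j)) q \<longleftrightarrow> circle_critical n (A \<omega>) q" for \<omega> q
    by (rule circle_critical_cong) (auto simp: F_def)
  then have "{\<omega> \<in> space M. \<forall>q. (\<forall>i. norm (q i) = 1) \<longrightarrow> circle_critical n (A \<omega>) q \<longrightarrow>
       norm (\<Sum>i<n. z i *\<^sub>R q i) / real n \<ge> c}
     = space M - F -` {w. \<exists>q\<in>?K. (q, w) \<in> ?T \<and> h (q, w) < c} \<inter> space M"
    by (auto simp: h_def not_less)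
  ultimately show ?thesis by auto
qed

section \<open>Correlation with high probability\<close>

text \<open>The noise scale sqrt n / lam turns the bound 1.7 n^(3/2) on the forms of A into (1.7 /
  lam) n^2, so the deterministic core applies with \<beta> = 1.7 / lam.\<close>

lemma circle_critical_correlation_if_forms_bounded:
  assumes n: "n \<ge> 1" and lam: "lam > 16" and z: "\<And>i. i < n \<Longrightarrow> \<bar>z i\<bar> = 1"
    and diag: "\<And>i. i < n \<Longrightarrow> A $$ (i, i) = 0"
    and bounded: "forms_bounded n z (17 / 10 * real n * sqrt n) A"
    and crit: "circle_critical n (\<lambda>i j. z i * z j + sqrt n / lam * A $$ (i, j)) q"
  shows "1 - 16 / lam \<le> norm (\<Sum>i<n. z i *\<^sub>R q i) / n"
proof -
  define E where "E i j = sqrt n / lam * (A $$ (i, j) * z i * z j)" for i j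
  have z2: "z i * z i = 1" if "i < n" for i
    using z[OF that] by (metis abs_mult_self_eq mult_1)
  have "circle_critical n (\<lambda>i j. z i * z j * (z i * z j + sqrt n / lam * A $$ (i, j))) (\<lambda>i. z i *\<^sub>R q i)"
    using crit z2 by (intro circle_critical_gauge) (auto simp: power2_eq_square)
  also have "?this \<longleftrightarrow> circle_critical n (\<lambda>i j. 1 + E i j) (\<lambda>i. z i *\<^sub>R q i)"
  proof (rule circle_critical_cong)
    fix i j assume "i < n" "j < n"
    have "z i * z j * (z i * z j + sqrt n / lam * A $$ (i, j)) = (z i * z i) * (z j * z j) + E i j"
      by (simp add: E_def algebra_simps)
    then show "z i * z j * (z i * z j + sqrt n / lam * A $$ (i, j)) = 1 + E i j"
      using z2 \<open>i < n\<close> \<open>j < n\<close> by simp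
  qed simp
  finally have crit': "circle_critical n (\<lambda>i j. 1 + E i j) (\<lambda>i. z i *\<^sub>R q i)" .
  define \<beta> where "\<beta> = 17 / 10 / lam"
  have scale: "\<bar>sqrt n / lam * f\<bar> \<le> \<beta> * (real n)\<^sup>2" if "\<bar>f\<bar> < 17 / 10 * real n * sqrt n" for f
  proof -
    have "\<bar>sqrt n / lam * f\<bar> = sqrt n / lam * \<bar>f\<bar>"
      using lam by (simp add: abs_mult)
    also have "\<dots> \<le> sqrt n / lam * (17 / 10 * real n * sqrt n)"
      using that lam by (intro mult_left_mono) auto
    also have "\<dots> = \<beta> * (real n * (sqrt n * sqrt n))"
      by (simp only: \<beta>_def divide_inverse ac_simps)
    also have "\<dots> = \<beta> * (real n)\<^sup>2" by (simp add: power2_eq_square)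
    finally show ?thesis .
  qed
  \<comment> \<open>The gauge change sends x to the entrywise product of z and x, again a sign
    vector; \<open>restrict\<close> makes it extensional.\<close>
  have signs: "restrict (\<lambda>i. z i * x i) {..<n} \<in> sign_vectors n" if "\<And>i. \<bar>x i\<bar> = 1" for x
  proof -
    have "z i * x i = -1 \<or> z i * x i = 1" if "i < n" for i
    proof -
      have "\<bar>z i * x i\<bar> = 1" using z[OF \<open>i < n\<close>] \<open>\<bar>x i\<bar> = 1\<close> by (simp add: abs_mult)
      then show ?thesis by linarith
    qed
    then show ?thesis by (auto simp: sign_vectors_def)
  qed
  have "1 - 17 / 2 * \<beta> \<le> norm (\<Sum>i<n. z i *\<^sub>R q i) / n"
  proof (rule circle_critical_correlation[OF n crit'])
    show "E i i = 0" if "i < n" for i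
      using diag that by (simp add: E_def)
  next
    fix x :: "nat \<Rightarrow> real" assume x: "\<And>i. \<bar>x i\<bar> = 1"
    let ?r = "restrict (\<lambda>i. z i * x i) {..<n}"
    have "(\<Sum>i<n. \<Sum>j<n. E i j * x i * x j) = sqrt n / lam * bilinear_form n A ?r ?r"
      unfolding bilinear_form_def sum_distrib_left E_def
      by (intro sum.cong refl) (simp add: ac_simps)
    then show "\<bar>\<Sum>i<n. \<Sum>j<n. E i j * x i * x j\<bar> \<le> \<beta> * (real n)\<^sup>2"
      using bounded signs[OF x] by (simp only: forms_bounded_def scale)
    have "(\<Sum>i<n. \<Sum>j<n. E i j * x j) = sqrt n / lam * bilinear_form n A z ?r"
      unfolding bilinear_form_def sum_distrib_left E_def
      by (intro sum.cong refl) (simp add: ac_simps)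
    then show "\<bar>\<Sum>i<n. \<Sum>j<n. E i j * x j\<bar> \<le> \<beta> * (real n)\<^sup>2"
      using bounded signs[OF x] by (simp only: forms_bounded_def scale)
  next
    show "\<beta> \<le> 107 / 1000" using lam by (simp add: \<beta>_def field_simps)
  qed
  \<comment> \<open>The constant is 8.5 * 1.7 = 14.45, below 16.\<close>
  moreover have "17 / 2 * \<beta> = 289 / 20 / lam" by (simp add: \<beta>_def)
  moreover have "289 / 20 / lam \<le> 16 / lam" using lam by (intro divide_right_mono) auto
  ultimately show ?thesis by linarith
qed

text \<open>The tail exponent is 2.89 n / 4, so the failure bound is 4 r^n with r = 2 exp
  (-289/400). The constant 1.7 is large enough for r < 1, because ln 2 \<le> 25/36 <
  289/400.\<close>

lemma union_bound_tendsto: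
  "(\<lambda>n. 1 - 4 * 2 ^ n * exp (- ((17 / 10 * real n * sqrt n)\<^sup>2 / (4 * (real n)\<^sup>2)))) \<longlonglongrightarrow> 1"
proof -
  define r where "r = 2 * exp (- (289 / 400) :: real)"
  have eq: "4 * 2 ^ n * exp (- ((17 / 10 * real n * sqrt n)\<^sup>2 / (4 * (real n)\<^sup>2))) = 4 * r ^ n" for n
  proof -
    have "(17 / 10 * real n * sqrt n)\<^sup>2 / (4 * (real n)\<^sup>2) = real n * (289 / 400)"
      \<comment> \<open>For n = 0 both sides vanish, as division by zero yields 0.\<close>
      by (cases "n = 0") (simp_all add: power_mult_distrib power_divide)
    then show ?thesis
      by (simp add: r_def power_mult_distrib flip: exp_of_nat_mult)
  qed
  have "ln 2 < (289 / 400 :: real)" using ln2_le_25_over_36 by simp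
  then have "2 < exp (289 / 400 :: real)" by (metis exp_less_mono exp_ln zero_less_numeral)
  then have "r < 1" by (simp add: r_def exp_minus field_simps)
  moreover have "r \<ge> 0" by (simp add: r_def)
  ultimately have "(\<lambda>n. r ^ n) \<longlonglongrightarrow> 0" by (intro LIMSEQ_realpow_zero)
  then have "(\<lambda>n. 1 - 4 * r ^ n) \<longlonglongrightarrow> 1 - 4 * 0" by (intro tendsto_diff tendsto_mult tendsto_const)
  then show ?thesis by (simp only: eq mult_zero_right diff_zero)
qed

text \<open>Distributions are given only below the diagonal; the other entries are zero or follow by
  pointwise symmetry.\<close>

lemma gaussian_wigner_entry_measurable:
  assumes W: "gaussian_wigner M n W" and ij: "i < n" "j < n"
  shows "(\<lambda>\<omega>. W \<omega> $$ (i, j)) \<in> borel_measurable M"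
proof -
  have below: "(\<lambda>\<omega>. W \<omega> $$ (i, j)) \<in> borel_measurable M" if "j < i" "i < n" for i j
    using W that by (auto simp: gaussian_wigner_def distributed_def)
  consider "j < i" | "i = j" | "i < j" by linarith
  then show ?thesis
  proof cases
    case 1
    then show ?thesis using below ij by simp
  next
    case 2
    then have "(\<lambda>\<omega>. W \<omega> $$ (i, j)) \<in> borel_measurable M \<longleftrightarrow> (\<lambda>_. 0 :: real) \<in> borel_measurable M"
      using W ij by (intro measurable_cong) (auto simp: gaussian_wigner_def)
    then show ?thesis by simp
  next
    case 3
    have "W \<omega> $$ (i, j) = W \<omega> $$ (j, i)" if "\<omega> \<in> space M" for \<omega>
    proof -
      have "W \<omega> \<in> carrier_mat n n" "(W \<omega>)\<^sup>T = W \<omega>"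
        using W that by (auto simp: gaussian_wigner_def)
      then show ?thesis using ij by (metis carrier_matD index_transpose_mat(1))
    qed
    then have "(\<lambda>\<omega>. W \<omega> $$ (i, j)) \<in> borel_measurable M \<longleftrightarrow> (\<lambda>\<omega>. W \<omega> $$ (j, i)) \<in> borel_measurable M"
      by (intro measurable_cong)
    then show ?thesis using below[OF 3] ij by simp
  qed
qed

theorem theorem3:
  fixes M :: "nat \<Rightarrow> 'w measure"
    and W :: "nat \<Rightarrow> 'w \<Rightarrow> real mat"
    and Y :: "nat \<Rightarrow> 'w \<Rightarrow> real mat"
    and z :: "nat \<Rightarrow> real vec"
    and lam \<sigma> :: "nat \<Rightarrow> real"
    and \<epsilon> :: real
  assumes lam: "\<And>n. n \<ge> 1 \<Longrightarrow> lam n > 16"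
    and z: "\<And>n. n \<ge> 1 \<Longrightarrow> z n \<in> carrier_vec n \<and> (\<forall>i<n. z n $ i \<in> {1, -1})"
    and \<sigma>: "\<And>n. n \<ge> 1 \<Longrightarrow> \<sigma> n = sqrt (real n) / lam n"
    and prob: "\<And>n. n \<ge> 1 \<Longrightarrow> prob_space (M n)"
    and W: "\<And>n. n \<ge> 1 \<Longrightarrow> gaussian_wigner (M n) n (W n)"
    and Y: "\<And>n \<omega>. n \<ge> 1 \<Longrightarrow> \<omega> \<in> space (M n) \<Longrightarrow>
              Y n \<omega> = outer_prod (z n) (z n) + \<sigma> n \<cdot>\<^sub>m W n \<omega>"
    and eps: "\<epsilon> > 0"
  shows "((\<lambda>n. \<P>(\<omega> in M n. \<forall>Q. second_order_critical_point n (Y n \<omega>) Q \<longrightarrow>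
              l2_norm_vec (Q\<^sup>T *\<^sub>v z n) / real n \<ge> 1 - (1 + \<epsilon>) * (16 / lam n)))
            \<longlonglongrightarrow> 1)
         \<and> (\<forall>n\<ge>1. 1 - (1 + \<epsilon>) * (16 / lam n) = 1 - (1 + \<epsilon>) * (16 * \<sigma> n / sqrt (real n)))"
proof (intro conjI allI impI)
  let ?good = "\<lambda>n \<omega>. \<forall>Q. second_order_critical_point n (Y n \<omega>) Q \<longrightarrow>
              l2_norm_vec (Q\<^sup>T *\<^sub>v z n) / real n \<ge> 1 - (1 + \<epsilon>) * (16 / lam n)"
  let ?s = "\<lambda>n. 17 / 10 * real n * sqrt (real n)"
  let ?bound = "\<lambda>n. 1 - 4 * 2 ^ n * exp (- ((?s n)\<^sup>2 / (4 * (real n)\<^sup>2)))"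
  \<comment> \<open>The probability is squeezed between the union bound and 1.\<close>
  have bounds: "?bound n \<le> \<P>(\<omega> in M n. ?good n \<omega>) \<and> \<P>(\<omega> in M n. ?good n \<omega>) \<le> 1" if n: "n \<ge> 1" for n
  proof -
    interpret prob_space "M n" by (rule prob[OF n])
    define y where "y i = z n $ i" for i
    have y: "\<bar>y i\<bar> = 1" if "i < n" for i
      using z[OF n] that by (auto simp: y_def)
    have zn: "z n \<in> carrier_vec n" using z[OF n] by simp
    have carrier: "W n \<omega> \<in> carrier_mat n n" and sym: "(W n \<omega>)\<^sup>T = W n \<omega>"
      and diag: "\<And>i. i < n \<Longrightarrow> W n \<omega> $$ (i, i) = 0" if "\<omega> \<in> space (M n)" for \<omega>
      using W[OF n] that by (auto simp: gaussian_wigner_def)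
    have Yc: "Y n \<omega> \<in> carrier_mat n n" if "\<omega> \<in> space (M n)" for \<omega>
      using carrier[OF that] zn by (simp add: Y[OF n that] outer_prod_def)
    have Y_index: "Y n \<omega> $$ (i, j) = y i * y j + sqrt n / lam n * W n \<omega> $$ (i, j)"
      if "\<omega> \<in> space (M n)" "i < n" "j < n" for \<omega> i j
      using carrier[OF that(1)] zn that by (simp add: Y[OF n that(1)] outer_prod_def \<sigma>[OF n] y_def)
    have Y_sym: "(Y n \<omega>)\<^sup>T = Y n \<omega>" if \<omega>: "\<omega> \<in> space (M n)" for \<omega>
    proof (rule eq_matI)
      fix i j assume "i < dim_row (Y n \<omega>)" "j < dim_col (Y n \<omega>)"
      then have ij: "i < n" "j < n" using Yc[OF \<omega>] by auto
      then have "W n \<omega> $$ (j, i) = W n \<omega> $$ (i, j)"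
        using carrier[OF \<omega>] sym[OF \<omega>] by (metis carrier_matD index_transpose_mat(1))
      then show "(Y n \<omega>)\<^sup>T $$ (i, j) = Y n \<omega> $$ (i, j)"
        using Yc[OF \<omega>] Y_index[OF \<omega>] ij by (simp add: mult.commute)
    qed (use Yc[OF \<omega>] in auto)
    let ?A = "\<lambda>\<omega> i j. y i * y j + sqrt n / lam n * W n \<omega> $$ (i, j)"
    have good_iff: "?good n \<omega> \<longleftrightarrow> (\<forall>q. (\<forall>i. norm (q i) = 1) \<longrightarrow> circle_critical n (?A \<omega>) q \<longrightarrow>
       norm (\<Sum>i<n. y i *\<^sub>R q i) / real n \<ge> 1 - (1 + \<epsilon>) * (16 / lam n))" if \<omega>: "\<omega> \<in> space (M n)" for \<omega>
    proof -
      have "circle_critical n (\<lambda>i j. Y n \<omega> $$ (i, j)) q \<longleftrightarrow> circle_critical n (?A \<omega>) q" for q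
        by (rule circle_critical_cong) (auto simp: Y_index \<omega>)
      then show ?thesis
        by (simp only: all_critical_points_iff[OF Yc[OF \<omega>] Y_sym[OF \<omega>] zn] y_def)
    qed
    \<comment> \<open>Monotonicity of the measure below requires the larger event, the one about
      critical points, to be measurable.\<close>
    have "{\<omega> \<in> space (M n). ?good n \<omega>} = {\<omega> \<in> space (M n). \<forall>q. (\<forall>i. norm (q i) = 1) \<longrightarrow>
       circle_critical n (?A \<omega>) q \<longrightarrow> norm (\<Sum>i<n. y i *\<^sub>R q i) / real n \<ge> 1 - (1 + \<epsilon>) * (16 / lam n)}"
      by (intro Collect_cong conj_cong refl good_iff)
    also have "\<dots> \<in> sets (M n)"
    proof (rule sets_all_critical)
      fix i j assume "i < n" "j < n"
      note [measurable] = gaussian_wigner_entry_measurable[OF W[OF n] this]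
      show "(\<lambda>\<omega>. ?A \<omega> i j) \<in> borel_measurable (M n)" by measurable
    qed
    finally have good_sets: "{\<omega> \<in> space (M n). ?good n \<omega>} \<in> sets (M n)" .
    have s: "?s n > 0" using n by simp
    have forms: "?bound n \<le> prob {\<omega> \<in> space (M n). forms_bounded n y (?s n) (W n \<omega>)}"
      by (rule gaussian_wigner_forms_bounded[OF prob[OF n] W[OF n] n s]) (rule y)
    have subset: "{\<omega> \<in> space (M n). forms_bounded n y (?s n) (W n \<omega>)} \<subseteq> {\<omega> \<in> space (M n). ?good n \<omega>}"
    proof safe
      fix \<omega> assume \<omega>: "\<omega> \<in> space (M n)" and bounded: "forms_bounded n y (?s n) (W n \<omega>)"
      \<comment> \<open>Since 16 / lam n is positive, the factor 1 + \<epsilon> only lowers the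
        bound.\<close>
      have weaken: "1 - (1 + \<epsilon>) * (16 / lam n) \<le> 1 - 16 / lam n"
      proof -
        have "1 * (16 / lam n) \<le> (1 + \<epsilon>) * (16 / lam n)"
          using eps lam[OF n] by (intro mult_right_mono) auto
        then show ?thesis by (simp only: mult_1 diff_left_mono)
      qed
      have "?good n \<omega>"
      proof (rule good_iff[OF \<omega>, THEN iffD2], intro allI impI)
        fix q assume crit: "circle_critical n (?A \<omega>) q"
        have "1 - 16 / lam n \<le> norm (\<Sum>i<n. y i *\<^sub>R q i) / n"
          by (rule circle_critical_correlation_if_forms_bounded[OF n lam[OF n] _ _ bounded crit]) (simp_all add: y diag[OF \<omega>])
        with weaken show "1 - (1 + \<epsilon>) * (16 / lam n) \<le> norm (\<Sum>i<n. y i *\<^sub>R q i) / n"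
          by (rule order_trans)
      qed
      then show "\<And>Q. second_order_critical_point n (Y n \<omega>) Q \<Longrightarrow>
          l2_norm_vec (Q\<^sup>T *\<^sub>v z n) / real n \<ge> 1 - (1 + \<epsilon>) * (16 / lam n)"
        by blast
    qed
    note forms
    also have "prob {\<omega> \<in> space (M n). forms_bounded n y (?s n) (W n \<omega>)} \<le> \<P>(\<omega> in M n. ?good n \<omega>)"
      using subset good_sets by (rule finite_measure_mono)
    finally have "?bound n \<le> \<P>(\<omega> in M n. ?good n \<omega>)" .
    then show ?thesis by simp
  qed
  show "(\<lambda>n. \<P>(\<omega> in M n. ?good n \<omega>)) \<longlonglongrightarrow> 1"
  proof (rule tendsto_sandwich[OF _ _ union_bound_tendsto tendsto_const])
    show "\<forall>\<^sub>F n in sequentially. ?bound n \<le> \<P>(\<omega> in M n. ?good n \<omega>)"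
      \<comment> \<open>The hypotheses speak of n \<ge> 1, so the squeeze starts at 1.\<close>
      using bounds by (intro eventually_sequentiallyI[of 1]) blast
    show "\<forall>\<^sub>F n in sequentially. \<P>(\<omega> in M n. ?good n \<omega>) \<le> 1"
      using bounds by (intro eventually_sequentiallyI[of 1]) blast
  qed
next
  fix n :: nat assume "n \<ge> 1"
  then show "1 - (1 + \<epsilon>) * (16 / lam n) = 1 - (1 + \<epsilon>) * (16 * \<sigma> n / sqrt (real n))"
    by (simp add: \<sigma>)
qed

end
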